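(* Fix constants $0<\beta<2/3$ and $\alpha\in(0,1)$ with $\alpha\ge\beta/2$. Consider $n\to\infty$ along values for which $r=\alpha n$ is an integer and $k=\beta n=2t$ is an even integer. Let $a=0^n$, $b=1^{2t}0^{n-2t}$, $c=1^t0^t1^t0^{n-3t}$ and $I_r(a,b,c)=|B_r(a)\cap B_r(b)\cap B_r(c)|$. Then $$\frac1n\log I_r(a,b,c)=f_3(\alpha,\beta)+o(1),$$ i.e. $I_r(a,b,c)=\exp\big((f_3(\alpha,\beta)+o(1))n\big)$, and consequently $$N_r^{(n)}(3,k)=\exp\big((f_3(\alpha,\beta)+o(1))n\big),$$ where $N_r^{(n)}(3,k)=\max\{|B_r(x_1)\cap B_r(x_2)\cap B_r(x_3)| : x_1,x_2,x_3\in\{0,1\}^n,\ d(x_i,x_j)\ge k \text{ for } i\ne j\}$.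
   Context: $d$ is the Hamming distance on $\{0,1\}^n$, $B_r(x)=\{y: d(x,y)\le r\}$, and $\log$ is the natural logarithm. $H(p)=-p\log p-(1-p)\log(1-p)$ for $p\in[0,1]$ is the binary entropy (natural log). For real $\theta,\delta$ define $\rho^\star(\theta,\delta)=\min\{\alpha,\ \delta+2\theta-\beta/2\}$, $p_1(\theta)=2\theta/\beta$, $p_{23}(\theta,\delta)=(\rho^\star(\theta,\delta)+\beta-\delta-2\theta)/\beta$, $p_4(\theta,\delta)=(\theta+\delta-\beta)/(1-3\beta/2)$. The feasible set is $\mathcal D_{\alpha,\beta}=\{(\theta,\delta): 0\le\delta\le\alpha,\ 0\le\rho^\star(\theta,\delta)\le\alpha,\ 0\le p_1(\theta)\le1,\ 0\le p_{23}(\theta,\delta)\le1,\ 0\le p_4(\theta,\delta)\le1\}$, and for $(\theta,\delta)\in\mathcal D_{\alpha,\beta}$, $\Phi_{\alpha,\beta}(\theta,\delta)=\frac{\beta}{2}H(p_1(\theta))+\beta H(p_{23}(\theta,\delta))+(1-\frac{3\beta}{2})H(p_4(\theta,\delta))$. Finally $f_3(\alpha,\beta)=\max_{(\theta,\delta)\in\mathcal D_{\alpha,\beta}}\Phi_{\alpha,\beta}(\theta,\delta)$. *)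

theory Defs
  imports Complex_Main "HOL-Library.Landau_Symbols"
begin

definition words :: "nat \<Rightarrow> bool list set" where
  "words n = {x. length x = n}"

definition hamming_dist :: "bool list \<Rightarrow> bool list \<Rightarrow> nat" where
  "hamming_dist x y = card {i. i < length x \<and> x ! i \<noteq> y ! i}"

definition hamming_ball :: "nat \<Rightarrow> bool list \<Rightarrow> bool list set" where
  "hamming_ball r x = {y \<in> words (length x). hamming_dist x y \<le> r}"

definition word_a :: "nat \<Rightarrow> bool list" where
  "word_a n = replicate n False"

definition word_b :: "nat \<Rightarrow> nat \<Rightarrow> bool list" where
  "word_b n t = replicate (2 * t) True @ replicate (n - 2 * t) False"

definition word_c :: "nat \<Rightarrow> nat \<Rightarrow> bool list" where
  "word_c n t = replicate t True @ replicate t False @ replicate t True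
     @ replicate (n - 3 * t) False"

definition triple_inter :: "nat \<Rightarrow> bool list \<Rightarrow> bool list \<Rightarrow> bool list \<Rightarrow> nat" where
  "triple_inter r x y z = card (hamming_ball r x \<inter> hamming_ball r y \<inter> hamming_ball r z)"

text \<open>Meaningful only if three words of length \<open>n\<close> at pairwise distance at least \<open>k\<close> exist;
  this holds for \<open>k = 2 * t\<close> with \<open>3 * t \<le> n\<close>.\<close>

definition N3 :: "nat \<Rightarrow> nat \<Rightarrow> nat \<Rightarrow> nat" where
  "N3 n r k = Max {triple_inter r x1 x2 x3 | x1 x2 x3.
     x1 \<in> words n \<and> x2 \<in> words n \<and> x3 \<in> words n \<and>
     k \<le> hamming_dist x1 x2 \<and> k \<le> hamming_dist x1 x3 \<and> k \<le> hamming_dist x2 x3}"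

text \<open>Since \<open>ln 0 = 0\<close>, the convention \<open>0 log 0 = 0\<close> at the endpoints is built in.\<close>

definition bin_entropy :: "real \<Rightarrow> real" where
  "bin_entropy p = - p * ln p - (1 - p) * ln (1 - p)"

definition rho_star :: "real \<Rightarrow> real \<Rightarrow> real \<Rightarrow> real \<Rightarrow> real" where
  "rho_star \<alpha> \<beta> \<theta> \<delta> = min \<alpha> (\<delta> + 2 * \<theta> - \<beta> / 2)"

definition p1 :: "real \<Rightarrow> real \<Rightarrow> real" where
  "p1 \<beta> \<theta> = 2 * \<theta> / \<beta>"

definition p23 :: "real \<Rightarrow> real \<Rightarrow> real \<Rightarrow> real \<Rightarrow> real" where
  "p23 \<alpha> \<beta> \<theta> \<delta> = (rho_star \<alpha> \<beta> \<theta> \<delta> + \<beta> - \<delta> - 2 * \<theta>) / \<beta>"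

definition p4 :: "real \<Rightarrow> real \<Rightarrow> real \<Rightarrow> real" where
  "p4 \<beta> \<theta> \<delta> = (\<theta> + \<delta> - \<beta>) / (1 - 3 * \<beta> / 2)"

definition feasible :: "real \<Rightarrow> real \<Rightarrow> (real \<times> real) set" where
  "feasible \<alpha> \<beta> = {(\<theta>, \<delta>).
     0 \<le> \<delta> \<and> \<delta> \<le> \<alpha> \<and>
     0 \<le> rho_star \<alpha> \<beta> \<theta> \<delta> \<and> rho_star \<alpha> \<beta> \<theta> \<delta> \<le> \<alpha> \<and>
     0 \<le> p1 \<beta> \<theta> \<and> p1 \<beta> \<theta> \<le> 1 \<and>
     0 \<le> p23 \<alpha> \<beta> \<theta> \<delta> \<and> p23 \<alpha> \<beta> \<theta> \<delta> \<le> 1 \<and>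
     0 \<le> p4 \<beta> \<theta> \<delta> \<and> p4 \<beta> \<theta> \<delta> \<le> 1}"

definition Phi :: "real \<Rightarrow> real \<Rightarrow> real \<Rightarrow> real \<Rightarrow> real" where
  "Phi \<alpha> \<beta> \<theta> \<delta> = \<beta> / 2 * bin_entropy (p1 \<beta> \<theta>) + \<beta> * bin_entropy (p23 \<alpha> \<beta> \<theta> \<delta>)
     + (1 - 3 * \<beta> / 2) * bin_entropy (p4 \<beta> \<theta> \<delta>)"

text \<open>\<open>Greatest\<close> rather than \<open>Sup\<close>: the value is specified only if the maximum is attained.\<close>

definition f3 :: "real \<Rightarrow> real \<Rightarrow> real" where
  "f3 \<alpha> \<beta> = (GREATEST v. \<exists>(\<theta>, \<delta>) \<in> feasible \<alpha> \<beta>. v = Phi \<alpha> \<beta> \<theta> \<delta>)"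

end

theory Submission
  imports Defs "HOL-Analysis.Analysis" "HOL-Real_Asymp.Real_Asymp"
begin

text \<open>Relative to the coordinatewise majority of three centres, the coordinates split into three
  blocks where one centre is outvoted and a common block. The number of words with prescribed
  numbers of disagreements in the blocks is a product of binomial coefficients, so up to polynomial
  factors the intersection has size \<open>exp (n E)\<close> for a constrained entropy maximum \<open>E\<close>.
  Concavity of the entropy allows equal densities \<open>x\<close> in the three blocks, and then \<open>E\<close> is the
  maximum of \<open>3 \<beta> / 2 H(x) + (1 - 3 \<beta> / 2) H(y)\<close> subject to
  \<open>\<beta> / 2 (1 + x) + (1 - 3 \<beta> / 2) y \<le> \<alpha>\<close>; this equals \<open>f3\<close>. The same averaging shows that
  centres further apart give no larger exponent, which bounds \<open>N3\<close>. For the lower bound, rounding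
  \<open>x\<close> and \<open>y\<close> down preserves the constraint.\<close>

subsection \<open>Entropy\<close>

text \<open>The perspective of the binary entropy: the exponent contributed by a block of size
  \<open>m\<close> containing \<open>u\<close> disagreements. It is homogeneous of degree one, so
  concavity becomes superadditivity and blocks can be merged without normalising.\<close>

definition entropy_mass :: "real \<Rightarrow> real \<Rightarrow> real" where
  "entropy_mass m u = m * bin_entropy (u / m)"

lemma bin_entropy_minus [simp]: "bin_entropy (1 - p) = bin_entropy p"
  by (simp add: bin_entropy_def algebra_simps)

lemma entropy_mass_eq:
  assumes "0 \<le> u" "u \<le> m"
  shows "entropy_mass m u = m * ln m - u * ln u - (m - u) * ln (m - u)"
proof (cases "u = 0 \<or> u = m")
  case True
  then show ?thesis using assms by (auto simp: entropy_mass_def bin_entropy_def)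
next
  case False
  then have *: "0 < u" "u < m" using assms by auto
  then have "1 - u / m = (m - u) / m" by (simp add: field_simps)
  then show ?thesis using *
    by (simp add: entropy_mass_def bin_entropy_def ln_div) (simp add: field_simps)
qed

text \<open>The tangent inequality \<open>ln s \<le> s - 1\<close> at \<open>s = q / u\<close>,
  scaled by \<open>u\<close>. The case \<open>q = 0\<close> with \<open>u > 0\<close> has to be
  excluded because \<open>ln 0 = 0\<close> would replace an infinite penalty by zero.\<close>

lemma mult_ln_diff_le:
  fixes u q :: real
  assumes "0 \<le> u" "0 \<le> q" "q = 0 \<longrightarrow> u = 0"
  shows "u * ln q - u * ln u \<le> q - u"
proof (cases "u = 0")
  case False
  then have *: "0 < u" "0 < q" using assms by (auto simp: less_le)
  have "u * ln (q / u) \<le> u * (q / u - 1)"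
    using * by (intro mult_left_mono ln_le_minus_one) auto
  also have "u * (q / u - 1) = q - u" using * by (simp add: algebra_simps)
  finally show ?thesis using * by (simp add: ln_div right_diff_distrib)
qed (use assms in auto)

text \<open>Gibbs' inequality: the cross entropy with respect to any density \<open>p\<close>
  dominates the entropy. The tangent inequality is applied to \<open>u\<close> against
  \<open>m * p\<close> and to \<open>m - u\<close> against \<open>m * (1 - p)\<close>; the
  right-hand sides cancel. The last two premises express absolute continuity.\<close>

lemma gibbs_entropy_mass:
  assumes "0 \<le> u" "u \<le> m" "0 \<le> p" "p \<le> 1" "p = 0 \<longrightarrow> u = 0" "p = 1 \<longrightarrow> u = m"
  shows "entropy_mass m u \<le> - u * ln p - (m - u) * ln (1 - p)"
proof (cases "m = 0")
  case True
  then show ?thesis using assms by (simp add: entropy_mass_def)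
next
  case False
  then have m: "0 < m" using assms by auto
  have A: "u * ln (m * p) - u * ln u \<le> m * p - u"
    using assms m by (intro mult_ln_diff_le) auto
  have B: "(m - u) * ln (m * (1 - p)) - (m - u) * ln (m - u) \<le> m * (1 - p) - (m - u)"
    using assms m by (intro mult_ln_diff_le) auto
  have A': "u * ln (m * p) = u * ln m + u * ln p"
    using assms m by (cases "p = 0") (auto simp: ln_mult algebra_simps)
  have B': "(m - u) * ln (m * (1 - p)) = (m - u) * ln m + (m - u) * ln (1 - p)"
    using assms m by (cases "p = 1") (auto simp: ln_mult distrib_left simp del: right_diff_distrib)
  show ?thesis using A B A' B' unfolding entropy_mass_eq[OF assms(1,2)]
    by (simp add: algebra_simps)
qed

text \<open>Concavity of the entropy in homogeneous form. Both masses are bounded by their cross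
  entropy with the pooled density \<open>p\<close>, and these two cross entropies add up exactly to
  the mass of the merged block.\<close>

lemma entropy_mass_superadditive:
  assumes "0 \<le> u" "u \<le> m" "0 \<le> v" "v \<le> k"
  shows "entropy_mass m u + entropy_mass k v \<le> entropy_mass (m + k) (u + v)"
proof (cases "m + k = 0")
  case True
  then have "m = 0" "k = 0" using assms by auto
  then show ?thesis by (simp add: entropy_mass_def)
next
  case False
  then have mk: "0 < m + k" using assms by auto
  define p where "p = (u + v) / (m + k)"
  have p: "0 \<le> p" "p \<le> 1" "p = 0 \<longrightarrow> u = 0 \<and> v = 0" "p = 1 \<longrightarrow> u = m \<and> v = k"
    using assms mk by (auto simp: p_def)
  have "entropy_mass m u \<le> - u * ln p - (m - u) * ln (1 - p)"
    using assms p by (intro gibbs_entropy_mass) auto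
  moreover have "entropy_mass k v \<le> - v * ln p - (k - v) * ln (1 - p)"
    using assms p by (intro gibbs_entropy_mass) auto
  moreover have "entropy_mass (m + k) (u + v) = - (u + v) * ln p - (m + k - (u + v)) * ln (1 - p)"
  proof -
    have uv: "u + v = (m + k) * p" using mk by (simp add: p_def)
    have "entropy_mass (m + k) (u + v) = (m + k) * bin_entropy p"
      by (simp add: entropy_mass_def p_def)
    then show ?thesis unfolding uv by (simp add: bin_entropy_def algebra_simps)
  qed
  ultimately show ?thesis by (simp add: algebra_simps)
qed

lemma bin_entropy_le_half:
  assumes "0 \<le> p" "p \<le> 1"
  shows "bin_entropy p \<le> bin_entropy (1 / 2)"
  using gibbs_entropy_mass[of p 1 "1/2"] assms
  by (simp add: entropy_mass_def bin_entropy_def algebra_simps)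

text \<open>By concavity the value at the mixture is at least the mixture of the values at
  \<open>x\<close> and at the maximiser \<open>1 / 2\<close>, and neither of these is below the
  value at \<open>x\<close>.\<close>

lemma bin_entropy_toward_half:
  assumes "0 \<le> x" "x \<le> 1" "0 \<le> l" "l \<le> 1"
  shows "bin_entropy x \<le> bin_entropy ((1 - l) * x + l / 2)"
proof -
  have "entropy_mass (1 - l) ((1 - l) * x) + entropy_mass l (l * (1 / 2))
      \<le> entropy_mass (1 - l + l) ((1 - l) * x + l * (1 / 2))"
    using assms by (intro entropy_mass_superadditive) (auto simp: mult_left_le)
  moreover have "entropy_mass (1 - l) ((1 - l) * x) = (1 - l) * bin_entropy x"
    by (simp add: entropy_mass_def)
  moreover have "entropy_mass l (l * (1 / 2)) = l * bin_entropy (1 / 2)"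
    by (simp add: entropy_mass_def)
  moreover have "l * bin_entropy x \<le> l * bin_entropy (1 / 2)"
    using assms by (intro mult_left_mono bin_entropy_le_half) auto
  moreover have "entropy_mass (1 - l + l) ((1 - l) * x + l * (1 / 2)) = bin_entropy ((1 - l) * x + l / 2)"
    by (simp add: entropy_mass_def)
  moreover have "bin_entropy x = (1 - l) * bin_entropy x + l * bin_entropy x"
    by (simp add: algebra_simps)
  ultimately show ?thesis by linarith
qed

text \<open>Here \<open>p\<close> is a convex combination of \<open>x\<close> and
  \<open>1 / 2\<close>, so monotonicity follows from concavity without derivatives.\<close>

lemma bin_entropy_mono_half:
  assumes "0 \<le> x" "x \<le> p" "p \<le> 1 / 2"
  shows "bin_entropy x \<le> bin_entropy p"
proof (cases "x = 1 / 2")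
  case True
  then have "p = x" using assms by linarith
  then show ?thesis by simp
next
  case False
  define l where "l = (p - x) / (1 / 2 - x)"
  have x: "x < 1 / 2" using False assms by auto
  have "(1 - l) * x + l / 2 = x + l * (1 / 2 - x)" by (simp add: algebra_simps)
  also have "\<dots> = p" using x by (simp add: l_def)
  finally have "(1 - l) * x + l / 2 = p" .
  moreover have "0 \<le> l" "l \<le> 1" using assms x by (auto simp: l_def)
  ultimately show ?thesis using bin_entropy_toward_half[of x l] assms by auto
qed

text \<open>Only the origin is delicate: the one-sided limit there is \<open>0\<close>, which agrees
  with the value given by \<open>ln 0 = 0\<close>.\<close>

lemma continuous_mult_ln: "continuous_on {0..} (\<lambda>x::real. x * ln x)"
  unfolding continuous_on_def
proof
  fix x :: real assume x: "x \<in> {0..}"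
  show "((\<lambda>x. x * ln x) \<longlongrightarrow> x * ln x) (at x within {0..})"
  proof (cases "x = 0")
    case True
    have "((\<lambda>x::real. x * ln x) \<longlongrightarrow> 0) (at_right 0)" by real_asymp
    then show ?thesis using True by (simp add: at_within_Ici_at_right)
  next
    case False
    then show ?thesis using x by (intro tendsto_intros) auto
  qed
qed

lemma continuous_bin_entropy: "continuous_on {0..1} bin_entropy"
proof -
  have *: "bin_entropy = (\<lambda>p. - (p * ln p) - (1 - p) * ln (1 - p))"
    by (simp add: bin_entropy_def fun_eq_iff)
  show ?thesis unfolding *
    by (intro continuous_on_diff continuous_on_minus continuous_on_subset[OF continuous_mult_ln]
        continuous_on_compose2[OF continuous_mult_ln, where f = "\<lambda>p. 1 - p"] continuous_intros) auto
qed

subsection \<open>Entropy bounds for binomial coefficients\<close>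

lemma exp_mult_ln_nat: "exp (real u * ln (real u)) = real u ^ u"
  by (cases "u = 0") (auto simp: exp_of_nat_mult)

lemma exp_entropy_mass_nat:
  assumes "u \<le> m"
  shows "exp (entropy_mass (real m) (real u)) * (real u ^ u * real (m - u) ^ (m - u)) = real m ^ m"
proof -
  have "entropy_mass (real m) (real u) =
      real m * ln (real m) - real u * ln (real u) - real (m - u) * ln (real (m - u))"
    using assms by (subst entropy_mass_eq) (auto simp: of_nat_diff)
  then show ?thesis
    by (simp add: exp_diff exp_mult_ln_nat)
qed

lemma nat_self_power_pos: "0 < real u ^ u"
  by (cases "u = 0") auto

text \<open>The term with index \<open>u\<close> in the binomial expansion of
  \<open>(u + (m - u)) ^ m\<close> is at most the whole sum \<open>m ^ m\<close>; dividing by the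
  weight of that term leaves the exponential of the entropy.\<close>

lemma binomial_le_exp_entropy:
  assumes "u \<le> m"
  shows "real (m choose u) \<le> exp (entropy_mass (real m) (real u))"
proof -
  have "real (m choose u) * (real u ^ u * real (m - u) ^ (m - u))
      \<le> (\<Sum>j\<le>m. real (m choose j) * real u ^ j * real (m - u) ^ (m - j))"
    using assms member_le_sum[of u "{..m}" "\<lambda>j. real (m choose j) * real u ^ j * real (m - u) ^ (m - j)"]
    by (simp add: mult.assoc)
  also have "\<dots> = (real u + real (m - u)) ^ m" by (rule binomial_ring[symmetric])
  also have "\<dots> = real m ^ m" using assms by (simp add: of_nat_diff)
  also have "\<dots> = exp (entropy_mass (real m) (real u)) * (real u ^ u * real (m - u) ^ (m - u))"
    using exp_entropy_mass_nat[OF assms] by simp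
  finally show ?thesis
    using nat_self_power_pos[of u] nat_self_power_pos[of "m - u"] by simp
qed

text \<open>Consecutive terms in \<open>j\<close> have ratio \<open>u / (j + 1)\<close>, which is at
  least \<open>1\<close> for \<open>j < u\<close> and at most \<open>1\<close> from
  \<open>j = u\<close> on.\<close>

lemma power_div_fact_le:
  "real u ^ j / fact j \<le> real u ^ u / fact u"
proof -
  define f where "f j = real u ^ j / fact j" for j
  have step: "f (Suc i) = f i * (real u / real (Suc i))" for i
    by (simp add: f_def field_simps)
  have nn: "0 \<le> f i" for i by (simp add: f_def)
  have up: "f i \<le> f (Suc i)" if "Suc i \<le> u" for i
    unfolding step using that nn[of i] mult_left_mono[of 1 "real u / real (Suc i)" "f i"] by simp
  have down: "f (Suc i) \<le> f i" if "u \<le> i" for i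
    unfolding step using that nn[of i] mult_left_mono[of "real u / real (Suc i)" 1 "f i"] by simp
  have "f j \<le> f u"
  proof (cases "j \<le> u")
    case True
    then show ?thesis
      by (induction rule: inc_induct) (auto intro: order_trans[OF up])
  next
    case False
    then have "u \<le> j" by simp
    then show ?thesis
      by (induction rule: dec_induct) (auto intro: order_trans[OF down])
  qed
  then show ?thesis by (simp add: f_def)
qed

text \<open>The binomial distribution with success probability \<open>u / m\<close> has its mode at \<open>u\<close>, because
  \<open>j \<mapsto> u^j / j!\<close> is maximal at \<open>j = u\<close>.\<close>

lemma exp_entropy_le_binomial:
  assumes "u \<le> m"
  shows "exp (entropy_mass (real m) (real u)) \<le> (real m + 1) * real (m choose u)"
proof -
  let ?w = "real u ^ u * real (m - u) ^ (m - u)"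
  \<comment> \<open>Splitting off \<open>fact m\<close> leaves one factor in \<open>j\<close> and
    one in \<open>m - j\<close>. Both are maximal at the same index \<open>j = u\<close>, so they
    can be bounded separately.\<close>
  have term_eq: "real (m choose j) * real u ^ j * real (m - u) ^ (m - j) =
      fact m * (real u ^ j / fact j * (real (m - u) ^ (m - j) / fact (m - j)))" if "j \<le> m" for j
    using that by (simp add: binomial_fact)
  have "real m ^ m = (real u + real (m - u)) ^ m" using assms by (simp add: of_nat_diff)
  also have "\<dots> = (\<Sum>j\<le>m. real (m choose j) * real u ^ j * real (m - u) ^ (m - j))"
    by (rule binomial_ring)
  also have "\<dots> \<le> (\<Sum>j\<le>m. real (m choose u) * ?w)"
  proof (rule sum_mono)
    fix j assume "j \<in> {..m}"
    then have "j \<le> m" by simp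
    show "real (m choose j) * real u ^ j * real (m - u) ^ (m - j) \<le> real (m choose u) * ?w"
      unfolding mult.assoc[of "real (m choose u)", symmetric] term_eq[OF \<open>j \<le> m\<close>] term_eq[OF assms]
      by (intro mult_left_mono mult_mono power_div_fact_le) auto
  qed
  also have "\<dots> = (real m + 1) * real (m choose u) * ?w" by simp
  finally have "exp (entropy_mass (real m) (real u)) * ?w \<le> (real m + 1) * real (m choose u) * ?w"
    using exp_entropy_mass_nat[OF assms] by simp
  then show ?thesis
    using nat_self_power_pos[of u] nat_self_power_pos[of "m - u"] by (simp add: mult_le_cancel_right)
qed

subsection \<open>Counting by disagreement profiles\<close>

text \<open>Here \<open>ui\<close> counts the positions of block \<open>i\<close> where a word
  disagrees with the majority. For binary words such a position agrees with centre \<open>i\<close>,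
  whence \<open>mi - ui\<close> in the constraint for that centre and \<open>uj\<close> for the
  other blocks.\<close>

definition profiles :: "nat \<Rightarrow> nat \<Rightarrow> nat \<Rightarrow> nat \<Rightarrow> nat \<Rightarrow> (nat \<times> nat \<times> nat \<times> nat) set" where
  "profiles r m1 m2 m3 m4 = {(u1, u2, u3, u4). u1 \<le> m1 \<and> u2 \<le> m2 \<and> u3 \<le> m3 \<and> u4 \<le> m4 \<and>
     m1 - u1 + u2 + u3 + u4 \<le> r \<and> u1 + (m2 - u2) + u3 + u4 \<le> r \<and> u1 + u2 + (m3 - u3) + u4 \<le> r}"

definition profile_weight :: "nat \<Rightarrow> nat \<Rightarrow> nat \<Rightarrow> nat \<Rightarrow> nat \<times> nat \<times> nat \<times> nat \<Rightarrow> nat" where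
  "profile_weight m1 m2 m3 m4 = (\<lambda>(u1, u2, u3, u4).
     (m1 choose u1) * (m2 choose u2) * (m3 choose u3) * (m4 choose u4))"

lemma profiles_subset: "profiles r m1 m2 m3 m4 \<subseteq> {..m1} \<times> {..m2} \<times> {..m3} \<times> {..m4}"
  by (auto simp: profiles_def)

lemma finite_profiles: "finite (profiles r m1 m2 m3 m4)"
  by (rule finite_subset[OF profiles_subset]) auto

lemma card_profiles_le:
  assumes "m1 + m2 + m3 + m4 = n"
  shows "card (profiles r m1 m2 m3 m4) \<le> (n + 1) ^ 4"
proof -
  have "card (profiles r m1 m2 m3 m4) \<le> card ({..m1} \<times> {..m2} \<times> {..m3} \<times> {..m4})"
    by (rule card_mono[OF _ profiles_subset]) auto
  also have "\<dots> = (m1 + 1) * ((m2 + 1) * ((m3 + 1) * (m4 + 1)))"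
    by (simp add: card_cartesian_product)
  also have "\<dots> \<le> (n + 1) * ((n + 1) * ((n + 1) * (n + 1)))"
    using assms by (intro mult_le_mono) auto
  also have "\<dots> = (n + 1) ^ 4" by (simp only: power4_eq_xxxx mult.assoc)
  finally show ?thesis .
qed

text \<open>A subset of a disjoint union is the same as its tuple of traces on the parts, and these
  can be chosen independently.\<close>

lemma card_subsets_with_profile:
  assumes "finite B1" "finite B2" "finite B3" "finite B4"
    and "B1 \<inter> B2 = {}" "B1 \<inter> B3 = {}" "B1 \<inter> B4 = {}" "B2 \<inter> B3 = {}" "B2 \<inter> B4 = {}" "B3 \<inter> B4 = {}"
  shows "card {D. D \<subseteq> B1 \<union> B2 \<union> B3 \<union> B4 \<and> (card (D \<inter> B1), card (D \<inter> B2), card (D \<inter> B3), card (D \<inter> B4)) = u}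
    = profile_weight (card B1) (card B2) (card B3) (card B4) u"
proof -
  obtain u1 u2 u3 u4 where u: "u = (u1, u2, u3, u4)" by (cases u) auto
  let ?P = "{A. A \<subseteq> B1 \<and> card A = u1} \<times> {A. A \<subseteq> B2 \<and> card A = u2} \<times>
    {A. A \<subseteq> B3 \<and> card A = u3} \<times> {A. A \<subseteq> B4 \<and> card A = u4}"
  let ?X = "{D. D \<subseteq> B1 \<union> B2 \<union> B3 \<union> B4 \<and> (card (D \<inter> B1), card (D \<inter> B2), card (D \<inter> B3), card (D \<inter> B4)) = u}"
  have "bij_betw (\<lambda>(A1, A2, A3, A4). A1 \<union> A2 \<union> A3 \<union> A4) ?P ?X"
  proof (rule bij_betwI[where g = "\<lambda>D. (D \<inter> B1, D \<inter> B2, D \<inter> B3, D \<inter> B4)"], goal_cases)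
    case 1
    have "(A1 \<union> A2 \<union> A3 \<union> A4) \<inter> B1 = A1 \<and> (A1 \<union> A2 \<union> A3 \<union> A4) \<inter> B2 = A2
      \<and> (A1 \<union> A2 \<union> A3 \<union> A4) \<inter> B3 = A3 \<and> (A1 \<union> A2 \<union> A3 \<union> A4) \<inter> B4 = A4"
      if "A1 \<subseteq> B1" "A2 \<subseteq> B2" "A3 \<subseteq> B3" "A4 \<subseteq> B4" for A1 A2 A3 A4
      using assms(5-) that by blast
    then show ?case by (auto simp: u)
  next
    case 2
    show ?case by (auto simp: u)
  next
    case (3 x)
    then show ?case using assms(5-) by (cases x) (simp, blast)
  next
    case (4 D)
    then show ?case by auto
  qed
  then have "card ?X = card ?P" by (simp add: bij_betw_same_card)
  then show ?thesis
    using assms by (simp add: card_cartesian_product n_subsets u profile_weight_def mult.assoc)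
qed

lemma finite_words: "finite (words n)"
  using finite_lists_length_eq[of "UNIV :: bool set" n] by (simp add: words_def)

text \<open>A word \<open>y\<close> is encoded by the set \<open>D\<close> of positions where it differs from the coordinatewise
  majority of the three centres; the block \<open>Bi\<close> collects the positions where \<open>xi\<close> is outvoted.\<close>

lemma triple_inter_eq_sum_profiles:
  assumes "x1 \<in> words n" "x2 \<in> words n" "x3 \<in> words n"
  obtains m1 m2 m3 m4 where
    "m1 + m2 + m3 + m4 = n"
    "hamming_dist x1 x2 = m1 + m2" "hamming_dist x1 x3 = m1 + m3" "hamming_dist x2 x3 = m2 + m3"
    "\<And>r. triple_inter r x1 x2 x3 = sum (profile_weight m1 m2 m3 m4) (profiles r m1 m2 m3 m4)"
proof -
  have len: "length x1 = n" "length x2 = n" "length x3 = n" using assms by (auto simp: words_def)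
  define mj where "mj i \<longleftrightarrow> (x1 ! i \<and> x2 ! i) \<or> (x1 ! i \<and> x3 ! i) \<or> (x2 ! i \<and> x3 ! i)" for i
  define B1 where "B1 = {i. i < n \<and> x1 ! i \<noteq> mj i}"
  define B2 where "B2 = {i. i < n \<and> x2 ! i \<noteq> mj i}"
  define B3 where "B3 = {i. i < n \<and> x3 ! i \<noteq> mj i}"
  define B4 where "B4 = {i. i < n \<and> x1 ! i = mj i \<and> x2 ! i = mj i \<and> x3 ! i = mj i}"
  note B_defs = B1_def B2_def B3_def B4_def
  have fin: "finite B1" "finite B2" "finite B3" "finite B4" by (auto simp: B_defs)
  \<comment> \<open>Among three bits at most one differs from the majority, so the blocks partition
    the positions, and two centres differ exactly on the union of their blocks.\<close>
  have disj: "B1 \<inter> B2 = {}" "B1 \<inter> B3 = {}" "B1 \<inter> B4 = {}" "B2 \<inter> B3 = {}" "B2 \<inter> B4 = {}" "B3 \<inter> B4 = {}"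
    unfolding B_defs mj_def by blast+
  have un: "B1 \<union> B2 \<union> B3 \<union> B4 = {..<n}" unfolding B_defs by auto
  have c4: "card (C1 \<union> C2 \<union> C3 \<union> C4) = card C1 + card C2 + card C3 + card C4"
    if "C1 \<subseteq> B1" "C2 \<subseteq> B2" "C3 \<subseteq> B3" "C4 \<subseteq> B4" for C1 C2 C3 C4
  proof -
    have f: "finite C1" "finite C2" "finite C3" "finite C4" 
      by (rule finite_subset[OF that(1) fin(1)] finite_subset[OF that(2) fin(2)]
          finite_subset[OF that(3) fin(3)] finite_subset[OF that(4) fin(4)])+
    have "C1 \<inter> C2 = {}" "(C1 \<union> C2) \<inter> C3 = {}" "(C1 \<union> C2 \<union> C3) \<inter> C4 = {}"
      using that disj by blast+
    then show ?thesis using f by (simp add: card_Un_disjoint)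
  qed
  have d12: "hamming_dist x1 x2 = card B1 + card B2"
  proof -
    have "{i. i < length x1 \<and> x1 ! i \<noteq> x2 ! i} = B1 \<union> B2 \<union> {} \<union> {}"
      unfolding len B_defs mj_def by auto
    then show ?thesis unfolding hamming_dist_def using c4[of B1 B2 "{}" "{}"] by simp
  qed
  have d13: "hamming_dist x1 x3 = card B1 + card B3"
  proof -
    have "{i. i < length x1 \<and> x1 ! i \<noteq> x3 ! i} = B1 \<union> {} \<union> B3 \<union> {}"
      unfolding len B_defs mj_def by auto
    then show ?thesis unfolding hamming_dist_def using c4[of B1 "{}" B3 "{}"] by simp
  qed
  have d23: "hamming_dist x2 x3 = card B2 + card B3"
  proof -
    have "{i. i < length x2 \<and> x2 ! i \<noteq> x3 ! i} = {} \<union> B2 \<union> B3 \<union> {}"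
      unfolding len B_defs mj_def by auto
    then show ?thesis unfolding hamming_dist_def using c4[of "{}" B2 B3 "{}"] by simp
  qed
  define E where "E y = {i. i < n \<and> y ! i \<noteq> mj i}" for y
  define prof where "prof D = (card (D \<inter> B1), card (D \<inter> B2), card (D \<inter> B3), card (D \<inter> B4))" for D
  have cE: "card (Bi - D) = card Bi - card (D \<inter> Bi)" if "finite Bi" for Bi D :: "nat set"
    using card_Diff_subset_Int[of Bi D] that by (simp add: Int_commute)
  have dy: "hamming_dist x1 y = card B1 - card (E y \<inter> B1) + card (E y \<inter> B2) + card (E y \<inter> B3) + card (E y \<inter> B4)"
    "hamming_dist x2 y = card (E y \<inter> B1) + (card B2 - card (E y \<inter> B2)) + card (E y \<inter> B3) + card (E y \<inter> B4)"
    "hamming_dist x3 y = card (E y \<inter> B1) + card (E y \<inter> B2) + (card B3 - card (E y \<inter> B3)) + card (E y \<inter> B4)" for y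
  proof -
    have "{i. i < length x1 \<and> x1 ! i \<noteq> y ! i} = (B1 - E y) \<union> (E y \<inter> B2) \<union> (E y \<inter> B3) \<union> (E y \<inter> B4)"
      unfolding len B_defs E_def mj_def by auto
    then show "hamming_dist x1 y = card B1 - card (E y \<inter> B1) + card (E y \<inter> B2) + card (E y \<inter> B3) + card (E y \<inter> B4)"
      unfolding hamming_dist_def using c4[of "B1 - E y" "E y \<inter> B2" "E y \<inter> B3" "E y \<inter> B4"] cE[OF fin(1), of "E y"] by simp
    have "{i. i < length x2 \<and> x2 ! i \<noteq> y ! i} = (E y \<inter> B1) \<union> (B2 - E y) \<union> (E y \<inter> B3) \<union> (E y \<inter> B4)"
      unfolding len B_defs E_def mj_def by auto
    then show "hamming_dist x2 y = card (E y \<inter> B1) + (card B2 - card (E y \<inter> B2)) + card (E y \<inter> B3) + card (E y \<inter> B4)"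
      unfolding hamming_dist_def using c4[of "E y \<inter> B1" "B2 - E y" "E y \<inter> B3" "E y \<inter> B4"] cE[OF fin(2), of "E y"] by simp
    have "{i. i < length x3 \<and> x3 ! i \<noteq> y ! i} = (E y \<inter> B1) \<union> (E y \<inter> B2) \<union> (B3 - E y) \<union> (E y \<inter> B4)"
      unfolding len B_defs E_def mj_def by auto
    then show "hamming_dist x3 y = card (E y \<inter> B1) + card (E y \<inter> B2) + (card B3 - card (E y \<inter> B3)) + card (E y \<inter> B4)"
      unfolding hamming_dist_def using c4[of "E y \<inter> B1" "E y \<inter> B2" "B3 - E y" "E y \<inter> B4"] cE[OF fin(3), of "E y"] by simp
  qed
  have bij: "bij_betw E (words n) (Pow {..<n})"
  proof (rule bij_betwI[where g = "\<lambda>D. map (\<lambda>i. mj i \<noteq> (i \<in> D)) [0..<n]"])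
    show "E \<in> words n \<rightarrow> Pow {..<n}" by (auto simp: E_def)
    show "(\<lambda>D. map (\<lambda>i. mj i \<noteq> (i \<in> D)) [0..<n]) \<in> Pow {..<n} \<rightarrow> words n" by (auto simp: words_def)
    show "map (\<lambda>i. mj i \<noteq> (i \<in> E y)) [0..<n] = y" if "y \<in> words n" for y
      using that by (intro nth_equalityI) (auto simp: words_def E_def)
    show "E (map (\<lambda>i. mj i \<noteq> (i \<in> D)) [0..<n]) = D" if "D \<in> Pow {..<n}" for D
      using that by (auto simp: E_def)
  qed
  have leB: "card (D \<inter> Bi) \<le> card Bi" if "finite Bi" for D Bi :: "nat set"
    using that by (intro card_mono) auto
  have main: "triple_inter r x1 x2 x3 = sum (profile_weight (card B1) (card B2) (card B3) (card B4))
      (profiles r (card B1) (card B2) (card B3) (card B4))" (is "_ = sum ?w ?P") for r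
  proof -
    let ?Y = "hamming_ball r x1 \<inter> hamming_ball r x2 \<inter> hamming_ball r x3"
    have Y: "y \<in> ?Y \<longleftrightarrow> y \<in> words n \<and> prof (E y) \<in> ?P" for y
      using leB[OF fin(1)] leB[OF fin(2)] leB[OF fin(3)] leB[OF fin(4)]
      by (auto simp: hamming_ball_def len dy profiles_def prof_def)
    have "E ` ?Y = {D \<in> Pow {..<n}. prof D \<in> ?P}"
    proof (intro set_eqI iffI)
      fix D assume "D \<in> E ` ?Y"
      then show "D \<in> {D \<in> Pow {..<n}. prof D \<in> ?P}" using Y by (auto simp: E_def)
    next
      fix D assume D: "D \<in> {D \<in> Pow {..<n}. prof D \<in> ?P}"
      then obtain y where "y \<in> words n" "E y = D"
        using bij_betw_imp_surj_on[OF bij] by (metis (no_types, lifting) imageE mem_Collect_eq)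
      then show "D \<in> E ` ?Y" using D Y by blast
    qed
    moreover have "inj_on E ?Y"
      by (rule inj_on_subset[OF bij_betw_imp_inj_on[OF bij]]) (use Y in blast)
    ultimately have "triple_inter r x1 x2 x3 = card {D \<in> Pow {..<n}. prof D \<in> ?P}"
      unfolding triple_inter_def by (metis card_image)
    also have "\<dots> = (\<Sum>u\<in>?P. card {D \<in> {D \<in> Pow {..<n}. prof D \<in> ?P}. prof D = u})"
    proof -
      have "prof ` {D \<in> Pow {..<n}. prof D \<in> ?P} \<subseteq> ?P" by blast
      then show ?thesis
        using sum.group[of "{D \<in> Pow {..<n}. prof D \<in> ?P}" ?P prof "\<lambda>_. 1::nat"] finite_profiles
        by simp
    qed
    also have "\<dots> = (\<Sum>u\<in>?P. ?w u)"
    proof (rule sum.cong[OF refl])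
      fix u assume "u \<in> ?P"
      then have "{D \<in> {D \<in> Pow {..<n}. prof D \<in> ?P}. prof D = u} = {D. D \<subseteq> B1 \<union> B2 \<union> B3 \<union> B4 \<and> prof D = u}"
        unfolding un by auto
      then show "card {D \<in> {D \<in> Pow {..<n}. prof D \<in> ?P}. prof D = u} = ?w u"
        unfolding prof_def using card_subsets_with_profile[OF fin disj, of u] by simp
    qed
    finally show ?thesis .
  qed
  have "card B1 + card B2 + card B3 + card B4 = n"
    using c4[of B1 B2 B3 B4] unfolding un by simp
  from that[OF this d12 d13 d23 main] show ?thesis .
qed

text \<open>Pairwise equal distances \<open>2 * t\<close> determine the block sizes: the three
  blocks of outvoted centres must each have size \<open>t\<close>.\<close>

lemma word_distances:
  assumes "3 * t \<le> n"
  shows "hamming_dist (word_a n) (word_b n t) = 2 * t"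
    "hamming_dist (word_a n) (word_c n t) = 2 * t"
    "hamming_dist (word_b n t) (word_c n t) = 2 * t"
proof -
  have a: "word_a n ! i = False" if "i < n" for i using that by (simp add: word_a_def)
  have b: "word_b n t ! i \<longleftrightarrow> i < 2 * t" if "i < n" for i
    using that assms by (simp add: word_b_def nth_append)
  have c: "word_c n t ! i \<longleftrightarrow> i < t \<or> (2 * t \<le> i \<and> i < 3 * t)" if "i < n" for i
    using that assms by (auto simp: word_c_def nth_append)
  have l: "length (word_a n) = n" "length (word_b n t) = n" "length (word_c n t) = n"
    using assms by (auto simp: word_a_def word_b_def word_c_def)
  have "{i. i < n \<and> word_a n ! i \<noteq> word_b n t ! i} = {..<2 * t}"
    using assms by (auto simp: a b)
  then show "hamming_dist (word_a n) (word_b n t) = 2 * t" by (simp add: hamming_dist_def l)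
  have "{i. i < n \<and> word_a n ! i \<noteq> word_c n t ! i} = {..<t} \<union> {2 * t..<3 * t}"
    using assms by (auto simp: a c)
  moreover have "card ({..<t} \<union> {2 * t..<3 * t}) = 2 * t"
    by (subst card_Un_disjoint) auto
  ultimately show "hamming_dist (word_a n) (word_c n t) = 2 * t"
    by (simp add: hamming_dist_def l)
  have "{i. i < n \<and> word_b n t ! i \<noteq> word_c n t ! i} = {t..<3 * t}"
    using assms by (auto simp: b c)
  then show "hamming_dist (word_b n t) (word_c n t) = 2 * t" by (simp add: hamming_dist_def l)
qed

subsection \<open>The symmetric optimisation problem\<close>

text \<open>The density of disagreements is \<open>x\<close> in each of three blocks of relative
  size \<open>\<beta> / 2\<close> and \<open>y\<close> in the common block. The last inequality
  bounds the normalised distance to a centre: its own block contributes \<open>1 - x\<close> and the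
  two others contribute \<open>2 * x\<close>.\<close>

definition sym_feasible :: "real \<Rightarrow> real \<Rightarrow> (real \<times> real) set" where
  "sym_feasible \<alpha> \<beta> = {(x, y). 0 \<le> x \<and> x \<le> 1 \<and> 0 \<le> y \<and> y \<le> 1 \<and>
     \<beta> / 2 * (1 + x) + (1 - 3 * \<beta> / 2) * y \<le> \<alpha>}"

definition sym_exponent :: "real \<Rightarrow> real \<Rightarrow> real \<Rightarrow> real" where
  "sym_exponent \<beta> x y = 3 * \<beta> / 2 * bin_entropy x + (1 - 3 * \<beta> / 2) * bin_entropy y"

text \<open>A suitable pair has \<open>p1 = 1 - x\<close> and \<open>p4 = y\<close>. Then
  \<open>p23\<close> lies between \<open>min x (1 / 2)\<close> and \<open>1 / 2\<close>, so
  replacing \<open>x\<close> by it cannot lower the entropy.\<close>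

lemma sym_exponent_le_Phi:
  assumes \<beta>: "0 < \<beta>" "\<beta> < 2 / 3" and xy: "(x, y) \<in> sym_feasible \<alpha> \<beta>"
  shows "\<exists>(\<theta>, \<delta>) \<in> feasible \<alpha> \<beta>. sym_exponent \<beta> x y \<le> Phi \<alpha> \<beta> \<theta> \<delta>"
proof -
  define \<theta> where "\<theta> = \<beta> * (1 - x) / 2"
  define \<delta> where "\<delta> = \<beta> / 2 * (1 + x) + (1 - 3 * \<beta> / 2) * y"
  have x: "0 \<le> x" "x \<le> 1" and y: "0 \<le> y" "y \<le> 1" and \<delta>: "\<delta> \<le> \<alpha>"
    using xy by (auto simp: sym_feasible_def \<delta>_def)
  have \<gamma>: "0 < 1 - 3 * \<beta> / 2" using \<beta> by simp
  have "0 \<le> \<beta> / 2 * (1 + x)" "0 \<le> (1 - 3 * \<beta> / 2) * y" "0 \<le> \<beta> * (1 - x)"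
    using \<beta> \<gamma> x y by (intro mult_nonneg_nonneg; simp)+
  then have nn: "0 \<le> \<delta>" "0 \<le> \<theta>" by (auto simp: \<delta>_def \<theta>_def)
  have P1: "p1 \<beta> \<theta> = 1 - x" using \<beta> by (simp add: p1_def \<theta>_def)
  have "\<theta> + \<delta> - \<beta> = (1 - 3 * \<beta> / 2) * y" by (simp add: \<theta>_def \<delta>_def field_simps)
  then have P4: "p4 \<beta> \<theta> \<delta> = y" using \<gamma> by (simp add: p4_def)
  define q where "q = p23 \<alpha> \<beta> \<theta> \<delta>"
  \<comment> \<open>The minimum in \<open>rho_star\<close> turns into a cap of \<open>1 / 2\<close>
    on \<open>q\<close>: either the bound \<open>\<alpha>\<close> is binding or \<open>q\<close>
    sits at the entropy maximum.\<close>
  have q: "\<beta> * q = min (\<alpha> + \<beta> - \<delta> - 2 * \<theta>) (\<beta> / 2)"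
    using \<beta> by (simp add: q_def p23_def rho_star_def min_def)
  have qx: "\<beta> * x \<le> \<alpha> + \<beta> - \<delta> - 2 * \<theta>" 
  proof -
    have "2 * \<theta> = \<beta> - \<beta> * x" by (simp add: \<theta>_def right_diff_distrib)
    then show ?thesis using \<delta> by simp
  qed
  have q_half: "q \<le> 1 / 2"
  proof -
    have "\<beta> * q \<le> \<beta> * (1 / 2)" unfolding q by linarith
    then show ?thesis using \<beta> by (simp only: mult_le_cancel_left_pos)
  qed
  have q_min: "min x (1 / 2) \<le> q"
  proof -
    have "\<beta> * min x (1 / 2) \<le> \<beta> * x" "\<beta> * min x (1 / 2) \<le> \<beta> * (1 / 2)"
      using \<beta> by (intro mult_left_mono; simp)+
    then have "\<beta> * min x (1 / 2) \<le> \<beta> * q" unfolding q using qx by simp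
    then show ?thesis using \<beta> by (simp only: mult_le_cancel_left_pos)
  qed
  have Hq: "bin_entropy x \<le> bin_entropy q"
  proof (cases "x \<le> 1 / 2")
    case True
    then show ?thesis using q_half q_min x by (intro bin_entropy_mono_half) auto
  next
    case False
    then have "q = 1 / 2" using q_half q_min by (auto simp: min_def)
    then show ?thesis using bin_entropy_le_half[OF x] by (simp only:)
  qed
  have rho: "0 \<le> rho_star \<alpha> \<beta> \<theta> \<delta>"
  proof -
    have "\<delta> + 2 * \<theta> - \<beta> / 2 = \<beta> * (1 - x) / 2 + \<beta> / 2 + (1 - 3 * \<beta> / 2) * y"
      by (simp add: \<theta>_def \<delta>_def field_simps)
    also have "\<dots> \<ge> 0" using \<beta> x y \<gamma> by (intro add_nonneg_nonneg mult_nonneg_nonneg divide_nonneg_nonneg) auto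
    finally show ?thesis using \<delta> nn by (simp add: rho_star_def)
  qed
  have "(\<theta>, \<delta>) \<in> feasible \<alpha> \<beta>"
    using nn \<delta> rho x y q_half q_min P1 P4 unfolding feasible_def q_def[symmetric]
    by (auto simp: rho_star_def min_def q_def[symmetric] split: if_splits)
  moreover have "sym_exponent \<beta> x y \<le> Phi \<alpha> \<beta> \<theta> \<delta>"
  proof -
    have "\<beta> * bin_entropy x \<le> \<beta> * bin_entropy q" using Hq \<beta> by (intro mult_left_mono) auto
    then show ?thesis by (simp add: Phi_def sym_exponent_def P1 P4 q_def[symmetric])
  qed
  ultimately show ?thesis by auto
qed

text \<open>The witness \<open>x\<close> averages the densities \<open>1 - p\<close>,
  \<open>q\<close>, \<open>q\<close> of three equal blocks, which by concavity does not lower the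
  entropy. The symmetric distance becomes the average of \<open>rho_star\<close>,
  \<open>\<delta>\<close> and \<open>\<delta>\<close>, each at most \<open>\<alpha>\<close>.\<close>

lemma Phi_le_sym_exponent:
  assumes \<beta>: "0 < \<beta>" "\<beta> < 2 / 3" and f: "(\<theta>, \<delta>) \<in> feasible \<alpha> \<beta>"
  shows "\<exists>(x, y) \<in> sym_feasible \<alpha> \<beta>. Phi \<alpha> \<beta> \<theta> \<delta> \<le> sym_exponent \<beta> x y"
proof -
  define p q y where "p = p1 \<beta> \<theta>" and "q = p23 \<alpha> \<beta> \<theta> \<delta>" and "y = p4 \<beta> \<theta> \<delta>"
  define x where "x = (1 - p + 2 * q) / 3"
  have b: "0 \<le> p" "p \<le> 1" "0 \<le> q" "q \<le> 1" "0 \<le> y" "y \<le> 1" "\<delta> \<le> \<alpha>" "rho_star \<alpha> \<beta> \<theta> \<delta> \<le> \<alpha>"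
    using f by (auto simp: feasible_def p_def q_def y_def)
  have \<gamma>: "0 < 1 - 3 * \<beta> / 2" using \<beta> by simp
  have e: "\<beta> * p = 2 * \<theta>" "\<beta> * q = rho_star \<alpha> \<beta> \<theta> \<delta> + \<beta> - \<delta> - 2 * \<theta>"
    "(1 - 3 * \<beta> / 2) * y = \<theta> + \<delta> - \<beta>"
    using \<beta> \<gamma> by (simp_all add: p_def q_def y_def p1_def p23_def p4_def)
  have "\<beta> / 2 * (1 + x) = (4 * \<beta> - \<beta> * p + 2 * (\<beta> * q)) / 6"
    by (simp add: x_def field_simps)
  then have "\<beta> / 2 * (1 + x) + (1 - 3 * \<beta> / 2) * y = (rho_star \<alpha> \<beta> \<theta> \<delta> + 2 * \<delta>) / 3"
    unfolding e by (simp add: field_simps)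
  also have "\<dots> \<le> \<alpha>" using b by simp
  finally have "(x, y) \<in> sym_feasible \<alpha> \<beta>"
    using b by (auto simp: sym_feasible_def x_def)
  moreover have "Phi \<alpha> \<beta> \<theta> \<delta> \<le> sym_exponent \<beta> x y"
  proof -
    have "entropy_mass 1 (1 - p) + entropy_mass 2 (2 * q) \<le> entropy_mass (1 + 2) (1 - p + 2 * q)"
      using b by (intro entropy_mass_superadditive) auto
    then have "bin_entropy p + 2 * bin_entropy q \<le> 3 * bin_entropy x"
      by (simp add: entropy_mass_def x_def)
    then have "\<beta> / 2 * (bin_entropy p + 2 * bin_entropy q) \<le> \<beta> / 2 * (3 * bin_entropy x)"
      using \<beta> by (intro mult_left_mono) auto
    then show ?thesis
      by (simp add: Phi_def sym_exponent_def p_def q_def y_def algebra_simps)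
  qed
  ultimately show ?thesis by auto
qed

text \<open>Compactness provides a maximiser of the symmetric problem, and the two comparisons carry
  the maximum over to \<open>Phi\<close> together with its attainment, which \<open>GREATEST\<close>
  requires.\<close>

lemma f3_eq_max_sym_exponent:
  assumes \<beta>: "0 < \<beta>" "\<beta> < 2 / 3" and \<alpha>: "\<beta> / 2 \<le> \<alpha>"
  obtains x y where "(x, y) \<in> sym_feasible \<alpha> \<beta>" "f3 \<alpha> \<beta> = sym_exponent \<beta> x y"
    "\<And>x' y'. (x', y') \<in> sym_feasible \<alpha> \<beta> \<Longrightarrow> sym_exponent \<beta> x' y' \<le> f3 \<alpha> \<beta>"
proof -
  let ?\<Psi> = "\<lambda>z. sym_exponent \<beta> (fst z) (snd z)"
  have eq: "sym_feasible \<alpha> \<beta> = ({0..1} \<times> {0..1}) \<inter>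
      {z. \<beta> / 2 * (1 + fst z) + (1 - 3 * \<beta> / 2) * snd z \<le> \<alpha>}"
    by (auto simp: sym_feasible_def)
  have "compact (sym_feasible \<alpha> \<beta>)" unfolding eq
    by (intro compact_Int_closed compact_Times closed_Collect_le continuous_intros) auto
  moreover have "(0, 0) \<in> sym_feasible \<alpha> \<beta>" using \<alpha> by (simp add: sym_feasible_def)
  then have "sym_feasible \<alpha> \<beta> \<noteq> {}" by auto
  moreover have "continuous_on (sym_feasible \<alpha> \<beta>) ?\<Psi>" unfolding sym_exponent_def
    by (intro continuous_intros continuous_on_compose2[OF continuous_bin_entropy])
      (auto simp: sym_feasible_def)
  ultimately obtain z where z: "z \<in> sym_feasible \<alpha> \<beta>" "\<And>w. w \<in> sym_feasible \<alpha> \<beta> \<Longrightarrow> ?\<Psi> w \<le> ?\<Psi> z"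
    using continuous_attains_sup[of "sym_feasible \<alpha> \<beta>" ?\<Psi>] by blast
  obtain x y where xy: "z = (x, y)" by (cases z)
  have bound: "Phi \<alpha> \<beta> \<theta> \<delta> \<le> sym_exponent \<beta> x y" if "(\<theta>, \<delta>) \<in> feasible \<alpha> \<beta>" for \<theta> \<delta>
    using Phi_le_sym_exponent[OF \<beta> that] z(2) xy by fastforce
  obtain \<theta> \<delta> where td: "(\<theta>, \<delta>) \<in> feasible \<alpha> \<beta>" "sym_exponent \<beta> x y \<le> Phi \<alpha> \<beta> \<theta> \<delta>"
    using sym_exponent_le_Phi[OF \<beta>] z(1) xy by blast
  have "f3 \<alpha> \<beta> = sym_exponent \<beta> x y" unfolding f3_def
  proof (rule Greatest_equality)
    \<comment> \<open>The pair obtained from the symmetric maximiser has \<open>Phi\<close> at least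
      the symmetric maximum, while \<open>bound\<close> gives the converse, so equality
      holds.\<close>
    show "\<exists>(\<theta>, \<delta>) \<in> feasible \<alpha> \<beta>. sym_exponent \<beta> x y = Phi \<alpha> \<beta> \<theta> \<delta>"
      using td bound[OF td(1)] by (intro bexI[of _ "(\<theta>, \<delta>)"]) auto
  qed (use bound in auto)
  then show ?thesis using that[of x y] z xy by auto
qed

text \<open>Averaging the three distance constraints makes the blocks symmetric; positions in excess of
  \<open>3 t\<close> then move to the common block with density \<open>(1 + x) / 3\<close>, which keeps the averaged
  distance and, lying between \<open>x\<close> and \<open>1 / 2\<close>, does not decrease the entropy.\<close>

lemma entropy_mass_profile_le:
  fixes m1 m2 m3 m4 u1 u2 u3 u4 n T R :: real
  assumes u: "0 \<le> u1" "u1 \<le> m1" "0 \<le> u2" "u2 \<le> m2" "0 \<le> u3" "u3 \<le> m3" "0 \<le> u4" "u4 \<le> m4"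
    and n: "0 < n" "m1 + m2 + m3 + m4 = n"
    and T: "2 * T = \<beta> * n" "2 * T \<le> m1 + m2" "2 * T \<le> m1 + m3" "2 * T \<le> m2 + m3"
    and R: "R = \<alpha> * n" "m1 - u1 + u2 + u3 + u4 \<le> R" "u1 + (m2 - u2) + u3 + u4 \<le> R"
      "u1 + u2 + (m3 - u3) + u4 \<le> R"
    and \<beta>: "0 < \<beta>" "\<beta> < 2 / 3"
  shows "\<exists>(x, y) \<in> sym_feasible \<alpha> \<beta>.
    entropy_mass m1 u1 + entropy_mass m2 u2 + entropy_mass m3 u3 + entropy_mass m4 u4
      \<le> n * sym_exponent \<beta> x y"
proof -
  define M U where "M = m1 + m2 + m3" and "U = u1 + u2 + u3"
  define x where "x = U / M"
  define z where "z = (1 + x) / 3"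
  define V where "V = (M - 3 * T) * z"
  define y where "y = (u4 + V) / (n - 3 * T)"
  have "0 < \<beta> * n" "\<beta> * n < 2 / 3 * n" using \<beta> n by simp_all
  then have Tpos: "0 < T" "3 * T < n" using T(1) by simp_all
  have M: "3 * T \<le> M" using T by (simp add: M_def)
  then have Mpos: "0 < M" using Tpos by simp
  have U: "0 \<le> U" "U \<le> M" using u by (simp_all add: U_def M_def)
  have x: "0 \<le> x" "x \<le> 1" using U Mpos by (simp_all add: x_def)
  then have z: "0 \<le> z" "z \<le> 1" by (simp_all add: z_def)
  have V: "0 \<le> V" "V \<le> M - 3 * T"
    using M z by (simp_all add: V_def mult_left_le)
  have m4: "m4 + (M - 3 * T) = n - 3 * T" using n by (simp add: M_def)
  have y: "0 \<le> y" "y \<le> 1" using V u Tpos m4 by (simp_all add: y_def)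
  have yT: "(n - 3 * T) * y = u4 + V" using Tpos by (simp add: y_def)
  have Mx: "M * x = U" using Mpos by (simp add: x_def)
  \<comment> \<open>The excess positions contribute \<open>(M - 3 * T) * (1 + x) / 3\<close>, which
    cancels the dependence on \<open>T\<close>.\<close>
  have "T * (1 + x) + (n - 3 * T) * y = M * (1 + x) / 3 + u4"
    unfolding yT V_def z_def by (simp add: field_simps)
  also have "\<dots> = (M + U) / 3 + u4" using Mx by (simp add: distrib_left)
  also have "\<dots> \<le> R" 
  proof -
    \<comment> \<open>The left-hand side is the sum of the three distances: each \<open>ui\<close>
      occurs once negatively and twice positively.\<close>
    have "M + U + 3 * u4 \<le> 3 * R" unfolding M_def U_def using R(2-4) by simp
    then show ?thesis by (simp add: field_simps)
  qed
  finally have "T * (1 + x) + (n - 3 * T) * y \<le> \<alpha> * n" using R(1) by simp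
  moreover have T': "T = \<beta> / 2 * n" using T(1) by simp
  ultimately have "n * (\<beta> / 2 * (1 + x) + (1 - 3 * \<beta> / 2) * y) \<le> n * \<alpha>"
    by (simp add: algebra_simps)
  then have "\<beta> / 2 * (1 + x) + (1 - 3 * \<beta> / 2) * y \<le> \<alpha>"
    using n(1) by (simp only: mult_le_cancel_left_pos)
  then have feas: "(x, y) \<in> sym_feasible \<alpha> \<beta>" using x y by (simp add: sym_feasible_def)
  have "entropy_mass m1 u1 + entropy_mass m2 u2 \<le> entropy_mass (m1 + m2) (u1 + u2)"
    using u by (intro entropy_mass_superadditive) auto
  moreover have "entropy_mass (m1 + m2) (u1 + u2) + entropy_mass m3 u3 \<le> entropy_mass M U"
    unfolding M_def U_def using u by (intro entropy_mass_superadditive) auto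
  moreover have "entropy_mass M U = 3 * T * bin_entropy x + (M - 3 * T) * bin_entropy x"
    by (simp add: entropy_mass_def x_def algebra_simps)
  moreover have "(M - 3 * T) * bin_entropy x \<le> entropy_mass (M - 3 * T) V"
  proof -
    \<comment> \<open>The density \<open>z\<close> is the convex combination of \<open>x\<close>
      with weight \<open>1 / 3\<close> and \<open>1 / 2\<close> with weight
      \<open>2 / 3\<close>.\<close>
    have "bin_entropy x \<le> bin_entropy z"
      using bin_entropy_toward_half[OF x, of "2 / 3"] by (simp add: z_def add_divide_distrib add.commute)
    then have "(M - 3 * T) * bin_entropy x \<le> (M - 3 * T) * bin_entropy z"
      using M by (intro mult_left_mono) auto
    also have "\<dots> = entropy_mass (M - 3 * T) V"
      by (cases "M - 3 * T = 0") (simp_all add: entropy_mass_def V_def)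
    finally show ?thesis .
  qed
  moreover have "entropy_mass m4 u4 + entropy_mass (M - 3 * T) V \<le> entropy_mass (n - 3 * T) (u4 + V)"
    using entropy_mass_superadditive[OF u(7,8) V] by (simp only: m4)
  moreover have "entropy_mass (n - 3 * T) (u4 + V) = (n - 3 * T) * bin_entropy y"
    by (simp add: entropy_mass_def y_def)
  moreover have "n * sym_exponent \<beta> x y = 3 * T * bin_entropy x + (n - 3 * T) * bin_entropy y"
    unfolding sym_exponent_def T' by (simp add: algebra_simps)
  ultimately have "entropy_mass m1 u1 + entropy_mass m2 u2 + entropy_mass m3 u3 + entropy_mass m4 u4
      \<le> n * sym_exponent \<beta> x y" by linarith
  then show ?thesis using feas by blast
qed

subsection \<open>Bounds for the triple intersection\<close>

text \<open>There are at most \<open>(n + 1) ^ 4\<close> profiles and each has weight at most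
  \<open>exp (n * f3 \<alpha> \<beta>)\<close>. Arbitrary sufficiently separated centres are
  allowed, so the bound also covers the maximum \<open>N3\<close>.\<close>

lemma triple_inter_upper:
  assumes \<beta>: "0 < \<beta>" "\<beta> < 2 / 3" and \<alpha>: "\<beta> / 2 \<le> \<alpha>"
    and n: "0 < n" "real r = \<alpha> * real n" "real (2 * t) = \<beta> * real n"
    and w: "x1 \<in> words n" "x2 \<in> words n" "x3 \<in> words n"
    and d: "2 * t \<le> hamming_dist x1 x2" "2 * t \<le> hamming_dist x1 x3" "2 * t \<le> hamming_dist x2 x3"
  shows "real (triple_inter r x1 x2 x3) \<le> (real n + 1) ^ 4 * exp (real n * f3 \<alpha> \<beta>)"
proof -
  obtain m1 m2 m3 m4 where m: "m1 + m2 + m3 + m4 = n"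
    "hamming_dist x1 x2 = m1 + m2" "hamming_dist x1 x3 = m1 + m3" "hamming_dist x2 x3 = m2 + m3"
    "\<And>r. triple_inter r x1 x2 x3 = sum (profile_weight m1 m2 m3 m4) (profiles r m1 m2 m3 m4)"
    using triple_inter_eq_sum_profiles[OF w] by blast
  let ?P = "profiles r m1 m2 m3 m4"
  have wt: "real (profile_weight m1 m2 m3 m4 u) \<le> exp (real n * f3 \<alpha> \<beta>)" if "u \<in> ?P" for u
  proof -
    obtain u1 u2 u3 u4 where u: "u = (u1, u2, u3, u4)" by (cases u) auto
    have le: "u1 \<le> m1" "u2 \<le> m2" "u3 \<le> m3" "u4 \<le> m4"
      and rr: "m1 - u1 + u2 + u3 + u4 \<le> r" "u1 + (m2 - u2) + u3 + u4 \<le> r" "u1 + u2 + (m3 - u3) + u4 \<le> r"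
      using that by (auto simp: profiles_def u)
    have R: "real m1 - real u1 + real u2 + real u3 + real u4 \<le> real r"
      "real u1 + (real m2 - real u2) + real u3 + real u4 \<le> real r"
      "real u1 + real u2 + (real m3 - real u3) + real u4 \<le> real r"
      using rr[THEN of_nat_mono[where ?'a = real]] le by (simp_all add: of_nat_diff)
    have sz: "real m1 + real m2 + real m3 + real m4 = real n" using m(1) by linarith
    have T: "2 * real t = \<beta> * real n" using n(3) by simp
    have "2 * t \<le> m1 + m2" "2 * t \<le> m1 + m3" "2 * t \<le> m2 + m3"
      using d by (simp_all only: m(2-4))
    then have D: "2 * real t \<le> real m1 + real m2" "2 * real t \<le> real m1 + real m3"
      "2 * real t \<le> real m2 + real m3" by linarith+
    have npos: "0 < real n" using n(1) by simp
    have "\<exists>(x, y) \<in> sym_feasible \<alpha> \<beta>.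
      entropy_mass (real m1) (real u1) + entropy_mass (real m2) (real u2)
        + entropy_mass (real m3) (real u3) + entropy_mass (real m4) (real u4)
        \<le> real n * sym_exponent \<beta> x y"
      by (rule entropy_mass_profile_le[OF _ _ _ _ _ _ _ _ npos sz T D n(2) R \<beta>]) (use le in simp_all)
    then obtain x y where xy: "(x, y) \<in> sym_feasible \<alpha> \<beta>"
      "entropy_mass (real m1) (real u1) + entropy_mass (real m2) (real u2)
        + entropy_mass (real m3) (real u3) + entropy_mass (real m4) (real u4)
        \<le> real n * sym_exponent \<beta> x y" by auto
    have "sym_exponent \<beta> x y \<le> f3 \<alpha> \<beta>"
      using f3_eq_max_sym_exponent[OF \<beta> \<alpha>] xy(1) by metis
    then have "real n * sym_exponent \<beta> x y \<le> real n * f3 \<alpha> \<beta>"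
      by (intro mult_left_mono) auto
    with xy(2) have ent: "entropy_mass (real m1) (real u1) + entropy_mass (real m2) (real u2)
        + entropy_mass (real m3) (real u3) + entropy_mass (real m4) (real u4) \<le> real n * f3 \<alpha> \<beta>"
      by linarith
    have "real (profile_weight m1 m2 m3 m4 u) \<le>
        exp (entropy_mass (real m1) (real u1)) * exp (entropy_mass (real m2) (real u2))
        * exp (entropy_mass (real m3) (real u3)) * exp (entropy_mass (real m4) (real u4))"
      unfolding u profile_weight_def prod.case of_nat_mult
      by (intro mult_mono binomial_le_exp_entropy le) auto
    also have "\<dots> \<le> exp (real n * f3 \<alpha> \<beta>)"
      unfolding exp_add[symmetric] using ent by simp
    finally show ?thesis .
  qed
  have "real (triple_inter r x1 x2 x3) = (\<Sum>u\<in>?P. real (profile_weight m1 m2 m3 m4 u))"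
    unfolding m(5) by simp
  also have "\<dots> \<le> real (card ?P) * exp (real n * f3 \<alpha> \<beta>)"
    by (rule sum_bounded_above) (rule wt)
  also have "\<dots> \<le> (real n + 1) ^ 4 * exp (real n * f3 \<alpha> \<beta>)"
  proof (rule mult_right_mono)
    have "real (card ?P) \<le> real ((n + 1) ^ 4)"
      using card_profiles_le[OF m(1)] by (rule of_nat_mono)
    then show "real (card ?P) \<le> (real n + 1) ^ 4" by (simp add: add.commute)
  qed simp
  finally show ?thesis .
qed

text \<open>A single profile \<open>(u, u, u, v)\<close> with rounded densities suffices. Each of
  its four binomial coefficients reaches its entropy bound up to a factor
  \<open>n + 1\<close>.\<close>

lemma triple_inter_lower:
  assumes xy: "(x, y) \<in> sym_feasible \<alpha> \<beta>" and t: "3 * t \<le> n"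
    and n: "real r = \<alpha> * real n" "real (2 * t) = \<beta> * real n"
  shows "exp (3 * entropy_mass (real t) \<lfloor>x * real t\<rfloor>
      + entropy_mass (real (n - 3 * t)) \<lfloor>y * real (n - 3 * t)\<rfloor>)
    \<le> (real n + 1) ^ 4 * real (triple_inter r (word_a n) (word_b n t) (word_c n t))"
proof -
  have "word_a n \<in> words n" "word_b n t \<in> words n" "word_c n t \<in> words n"
    using t by (auto simp: words_def word_a_def word_b_def word_c_def)
  then obtain m1 m2 m3 m4 where m0: "m1 + m2 + m3 + m4 = n"
    "hamming_dist (word_a n) (word_b n t) = m1 + m2" "hamming_dist (word_a n) (word_c n t) = m1 + m3"
    "hamming_dist (word_b n t) (word_c n t) = m2 + m3"
    "\<And>r. triple_inter r (word_a n) (word_b n t) (word_c n t)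
      = sum (profile_weight m1 m2 m3 m4) (profiles r m1 m2 m3 m4)"
    using triple_inter_eq_sum_profiles by blast
  then have m: "m1 = t" "m2 = t" "m3 = t" "m4 = n - 3 * t"
    using word_distances[OF t] by linarith+
  define N where "N = n - 3 * t"
  define u where "u = nat \<lfloor>x * real t\<rfloor>"
  define v where "v = nat \<lfloor>y * real N\<rfloor>"
  have x: "0 \<le> x" "x \<le> 1" and y: "0 \<le> y" "y \<le> 1"
    and c: "\<beta> / 2 * (1 + x) + (1 - 3 * \<beta> / 2) * y \<le> \<alpha>"
    using xy by (auto simp: sym_feasible_def)
  have u: "real u \<le> x * real t" "of_int \<lfloor>x * real t\<rfloor> = real u"
    using x by (simp_all add: u_def)
  have v: "real v \<le> y * real N" "of_int \<lfloor>y * real N\<rfloor> = real v"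
    using y by (simp_all add: v_def)
  have "x * real t \<le> real t" "y * real N \<le> real N"
    using x y by (simp_all add: mult_left_le_one_le)
  then have le: "u \<le> t" "v \<le> N" using u v by linarith+
  have "real (t + u + v) \<le> real t * (1 + x) + real N * y" using u v by (simp add: algebra_simps)
  also have "\<dots> = real n * (\<beta> / 2 * (1 + x) + (1 - 3 * \<beta> / 2) * y)"
  proof -
    have T: "real t = \<beta> / 2 * real n" using n by simp
    have N: "real N = real n - 3 * real t" using t by (simp add: N_def of_nat_diff)
    show ?thesis unfolding N T by (simp add: algebra_simps)
  qed
  also have "\<dots> \<le> real n * \<alpha>" using c by (intro mult_left_mono) auto
  also have "\<dots> = real r" using n by simp
  finally have "t + u + v \<le> r" by linarith
  then have "(u, u, u, v) \<in> profiles r t t t N" using le by (auto simp: profiles_def)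
  then have "profile_weight t t t N (u, u, u, v) \<le> triple_inter r (word_a n) (word_b n t) (word_c n t)"
    unfolding m0(5) m N_def[symmetric] by (intro member_le_sum finite_profiles) auto
  then have W: "real ((t choose u) * (t choose u) * (t choose u) * (N choose v))
      \<le> real (triple_inter r (word_a n) (word_b n t) (word_c n t))"
    unfolding profile_weight_def prod.case by (rule of_nat_mono)
  have Et: "exp (entropy_mass (real t) (real u)) \<le> (real n + 1) * real (t choose u)"
    by (rule order_trans[OF exp_entropy_le_binomial[OF le(1)]]) (use t in \<open>simp add: mult_right_mono\<close>)
  have EN: "exp (entropy_mass (real N) (real v)) \<le> (real n + 1) * real (N choose v)"
    by (rule order_trans[OF exp_entropy_le_binomial[OF le(2)]]) (simp add: mult_right_mono N_def)
  have "exp (3 * entropy_mass (real t) (real u) + entropy_mass (real N) (real v))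
    = exp (entropy_mass (real t) (real u)) * exp (entropy_mass (real t) (real u))
      * exp (entropy_mass (real t) (real u)) * exp (entropy_mass (real N) (real v))"
    unfolding exp_add[symmetric] by (simp add: algebra_simps)
  also have "\<dots> \<le> ((real n + 1) * real (t choose u)) * ((real n + 1) * real (t choose u))
      * ((real n + 1) * real (t choose u)) * ((real n + 1) * real (N choose v))"
    by (intro mult_mono Et EN) auto
  also have "\<dots> = (real n + 1) ^ 4 * real ((t choose u) * (t choose u) * (t choose u) * (N choose v))"
    by (simp add: power4_eq_xxxx)
  also have "\<dots> \<le> (real n + 1) ^ 4 * real (triple_inter r (word_a n) (word_b n t) (word_c n t))"
    using W by (intro mult_left_mono) auto
  finally show ?thesis unfolding N_def[symmetric] u(2) v(2) .
qed

section \<open>Rounded densities in the limit\<close>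

lemma tendsto_floor_mult_divide:
  fixes s :: "'a \<Rightarrow> real"
  assumes s: "filterlim s at_top G"
  shows "((\<lambda>n. of_int \<lfloor>x * s n\<rfloor> / s n) \<longlongrightarrow> x) G"
proof (rule tendsto_sandwich)
  have pos: "eventually (\<lambda>n. s n > 0) G"
    using s by (simp add: filterlim_at_top_dense)
  show "eventually (\<lambda>n. x - 1 / s n \<le> of_int \<lfloor>x * s n\<rfloor> / s n) G"
    using pos
  proof eventually_elim
    case (elim n)
    have "x * s n - 1 \<le> of_int \<lfloor>x * s n\<rfloor>" by linarith
    then have "(x * s n - 1) / s n \<le> of_int \<lfloor>x * s n\<rfloor> / s n"
      using elim by (intro divide_right_mono) auto
    then show ?case using elim by (simp add: diff_divide_distrib)
  qed
  show "eventually (\<lambda>n. of_int \<lfloor>x * s n\<rfloor> / s n \<le> x) G"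
    using pos by eventually_elim (simp add: pos_divide_le_eq)
  have "((\<lambda>n. 1 / s n) \<longlongrightarrow> 0) G"
    using tendsto_inverse_0_at_top[OF s] by (simp add: inverse_eq_divide)
  from tendsto_diff[OF tendsto_const this, of x] show "((\<lambda>n. x - 1 / s n) \<longlongrightarrow> x) G" by simp
qed simp

text \<open>Rounding down keeps the density eventually inside the closed unit interval, so
  continuity there suffices even when \<open>x\<close> is an endpoint.\<close>

lemma tendsto_bin_entropy_floor:
  fixes s :: "'a \<Rightarrow> real"
  assumes s: "filterlim s at_top G" and x: "0 \<le> x" "x \<le> 1"
  shows "((\<lambda>n. bin_entropy (of_int \<lfloor>x * s n\<rfloor> / s n)) \<longlongrightarrow> bin_entropy x) G"
proof (rule continuous_on_tendsto_compose[OF continuous_bin_entropy tendsto_floor_mult_divide[OF s]])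
  show "x \<in> {0..1}" using x by simp
  have "eventually (\<lambda>n. s n > 0) G" using s by (simp add: filterlim_at_top_dense)
  then show "eventually (\<lambda>n. of_int \<lfloor>x * s n\<rfloor> / s n \<in> {0..1}) G"
  proof eventually_elim
    case (elim n)
    have "x * s n \<le> s n" using elim x by (simp add: mult_left_le_one_le)
    then have "of_int \<lfloor>x * s n\<rfloor> \<le> s n" by linarith
    moreover have "0 \<le> \<lfloor>x * s n\<rfloor>" using elim x by simp
    ultimately show ?case using elim by simp
  qed
qed

text \<open>The three special words compete in the maximum, which makes the underlying set nonempty;
  that set is finite, so some triple attains the maximum and obeys the general upper bound.\<close>

lemma N3_bounds:
  assumes \<beta>: "0 < \<beta>" "\<beta> < 2 / 3" and \<alpha>: "\<beta> / 2 \<le> \<alpha>"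
    and n: "0 < n" "real r = \<alpha> * real n" "real (2 * t) = \<beta> * real n"
    and t: "3 * t \<le> n"
  shows "triple_inter r (word_a n) (word_b n t) (word_c n t) \<le> N3 n r (2 * t)"
    and "real (N3 n r (2 * t)) \<le> (real n + 1) ^ 4 * exp (real n * f3 \<alpha> \<beta>)"
proof -
  let ?A = "{triple_inter r x1 x2 x3 | x1 x2 x3.
     x1 \<in> words n \<and> x2 \<in> words n \<and> x3 \<in> words n \<and>
     2 * t \<le> hamming_dist x1 x2 \<and> 2 * t \<le> hamming_dist x1 x3 \<and> 2 * t \<le> hamming_dist x2 x3}"
  have "?A \<subseteq> (\<lambda>(x1, x2, x3). triple_inter r x1 x2 x3) ` (words n \<times> words n \<times> words n)"
    by force
  then have fin: "finite ?A" by (rule finite_subset) (simp add: finite_words)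
  have "word_a n \<in> words n" "word_b n t \<in> words n" "word_c n t \<in> words n"
    using t by (auto simp: words_def word_a_def word_b_def word_c_def)
  moreover note word_distances[OF t]
  ultimately have mem: "triple_inter r (word_a n) (word_b n t) (word_c n t) \<in> ?A"
    by (metis (mono_tags, lifting) mem_Collect_eq order_refl)
  then show "triple_inter r (word_a n) (word_b n t) (word_c n t) \<le> N3 n r (2 * t)"
    unfolding N3_def using fin by (intro Max_ge)
  have "Max ?A \<in> ?A" using fin mem by (intro Max_in) auto
  then obtain x1 x2 x3 where "N3 n r (2 * t) = triple_inter r x1 x2 x3"
    "x1 \<in> words n" "x2 \<in> words n" "x3 \<in> words n"
    "2 * t \<le> hamming_dist x1 x2" "2 * t \<le> hamming_dist x1 x3" "2 * t \<le> hamming_dist x2 x3"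
    unfolding N3_def by blast
  then show "real (N3 n r (2 * t)) \<le> (real n + 1) ^ 4 * exp (real n * f3 \<alpha> \<beta>)"
    using triple_inter_upper[OF \<beta> \<alpha> n] by simp
qed

section \<open>From bounds to exponential growth rates\<close>

lemma exp_form_of_log_rate:
  fixes a :: "nat \<Rightarrow> real"
  assumes "((\<lambda>n. ln (a n) / real n) \<longlongrightarrow> c) F" "\<forall>\<^sub>F n in F. 0 < n \<and> 0 < a n"
  shows "(\<lambda>n. ln (a n) / real n - c) \<in> o[F](\<lambda>_. 1)"
    and "\<exists>\<epsilon> \<in> o[F](\<lambda>_. 1). \<forall>\<^sub>F n in F. a n = exp ((c + \<epsilon> n) * real n)"
proof -
  show *: "(\<lambda>n. ln (a n) / real n - c) \<in> o[F](\<lambda>_. 1)"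
    using assms(1) by (intro smalloI_tendsto) (auto simp: LIM_zero)
  show "\<exists>\<epsilon> \<in> o[F](\<lambda>_. 1). \<forall>\<^sub>F n in F. a n = exp ((c + \<epsilon> n) * real n)"
    \<comment> \<open>The error \<open>\<epsilon>\<close> is the deviation of the rate from
      \<open>c\<close>; positivity of \<open>a n\<close> makes
      \<open>exp (ln (a n)) = a n\<close>.\<close>
    by (rule bexI[OF _ *]) (use assms(2) in eventually_elim, simp)
qed

theorem theorem1:
  fixes \<alpha> \<beta> :: real and S :: "nat set" and r k t :: "nat \<Rightarrow> nat" and F :: "nat filter"
  assumes "0 < \<beta>" and "\<beta> < 2 / 3" and "0 < \<alpha>" and "\<alpha> < 1" and "\<beta> / 2 \<le> \<alpha>"
    and "\<And>n. n \<in> S \<Longrightarrow> real (r n) = \<alpha> * real n"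
    and "\<And>n. n \<in> S \<Longrightarrow> real (k n) = \<beta> * real n"
    and "\<And>n. n \<in> S \<Longrightarrow> k n = 2 * t n"
    and "F = inf at_top (principal S)"
  shows "(\<lambda>n. ln (real (triple_inter (r n) (word_a n) (word_b n (t n)) (word_c n (t n)))) / real n
             - f3 \<alpha> \<beta>) \<in> o[F](\<lambda>_. 1)
    \<and> (\<exists>\<epsilon> \<in> o[F](\<lambda>_. 1). \<forall>\<^sub>F n in F.
         real (triple_inter (r n) (word_a n) (word_b n (t n)) (word_c n (t n)))
           = exp ((f3 \<alpha> \<beta> + \<epsilon> n) * real n))
    \<and> (\<exists>\<epsilon> \<in> o[F](\<lambda>_. 1). \<forall>\<^sub>F n in F.
         real (N3 n (r n) (k n)) = exp ((f3 \<alpha> \<beta> + \<epsilon> n) * real n))"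
proof -
  define I where "I n = triple_inter (r n) (word_a n) (word_b n (t n)) (word_c n (t n))" for n
  define N where "N n = N3 n (r n) (k n)" for n
  define \<gamma> where "\<gamma> = 1 - 3 * \<beta> / 2"
  have \<gamma>: "0 < \<gamma>" using assms(2) by (simp add: \<gamma>_def)
  obtain x y where xy: "(x, y) \<in> sym_feasible \<alpha> \<beta>" "f3 \<alpha> \<beta> = sym_exponent \<beta> x y"
    using f3_eq_max_sym_exponent[OF assms(1,2,5)] by metis
  have xy01: "0 \<le> x" "x \<le> 1" "0 \<le> y" "y \<le> 1" using xy by (auto simp: sym_feasible_def)
  \<comment> \<open>The normalised logarithm of the factor \<open>(n + 1) ^ 4\<close> lost in either
    bound.\<close>
  define err where "err n = 4 * ln (real n + 1) / real n" for n
  \<comment> \<open>The lower exponent with the block sizes replaced by the reals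
    \<open>\<beta> / 2 * n\<close> and \<open>\<gamma> * n\<close>. These agree with the actual
    sizes on \<open>S\<close>, while the limit can be taken over all \<open>n\<close>.\<close>
  define L where "L n = 3 * \<beta> / 2 * bin_entropy (of_int \<lfloor>x * (\<beta> / 2 * real n)\<rfloor> / (\<beta> / 2 * real n))
      + \<gamma> * bin_entropy (of_int \<lfloor>y * (\<gamma> * real n)\<rfloor> / (\<gamma> * real n)) - err n" for n
  have err: "(err \<longlongrightarrow> 0) at_top"
    unfolding err_def by real_asymp
  have lin: "filterlim (\<lambda>n. c * real n) at_top at_top" if "0 < c" for c :: real
    using that by (intro filterlim_tendsto_pos_mult_at_top[OF tendsto_const]) (auto simp: filterlim_real_sequentially)
  have "(L \<longlongrightarrow> 3 * \<beta> / 2 * bin_entropy x + \<gamma> * bin_entropy y - 0) at_top"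
    unfolding L_def
    by (intro tendsto_diff tendsto_add tendsto_mult tendsto_const err tendsto_bin_entropy_floor lin xy01)
      (use assms(1) \<gamma> in auto)
  then have L: "(L \<longlongrightarrow> f3 \<alpha> \<beta>) at_top" unfolding xy(2) by (simp add: sym_exponent_def \<gamma>_def)
  have U: "((\<lambda>n. f3 \<alpha> \<beta> + err n) \<longlongrightarrow> f3 \<alpha> \<beta>) at_top"
    using tendsto_add[OF tendsto_const err] by simp
  have F: "F \<le> at_top" using assms(9) by simp
  have bounds: "0 < n \<and> 0 < real (I n) \<and> I n \<le> N n
      \<and> L n \<le> ln (real (I n)) / real n \<and> ln (real (N n)) / real n \<le> f3 \<alpha> \<beta> + err n"
    if n: "n \<in> S" "0 < n" for n
  proof -
    have r: "real (r n) = \<alpha> * real n" and t: "real (2 * t n) = \<beta> * real n" and k: "k n = 2 * t n"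
      using assms(6-8) n(1) by metis+
    have "\<beta> * real n < 2 / 3 * real n" using n(2) assms(2) by simp
    then have t3: "3 * t n \<le> n" using t by linarith
    have T: "real (t n) = \<beta> / 2 * real n" using t by simp
    have R: "real (n - 3 * t n) = \<gamma> * real n"
      using t3 T by (simp add: \<gamma>_def of_nat_diff algebra_simps)
    note nb = N3_bounds[OF assms(1,2,5) n(2) r t t3, folded k]
    let ?E = "3 * entropy_mass (real (t n)) \<lfloor>x * real (t n)\<rfloor>
      + entropy_mass (real (n - 3 * t n)) \<lfloor>y * real (n - 3 * t n)\<rfloor>"
    have low: "exp ?E \<le> (real n + 1) ^ 4 * real (I n)"
      using triple_inter_lower[OF xy(1) t3 r t] by (simp only: I_def)
    \<comment> \<open>Positivity has to come before any logarithm, since \<open>ln 0 = 0\<close>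
      would hide an empty intersection.\<close>
    have Ipos: "0 < real (I n)"
    proof (rule ccontr)
      assume "\<not> 0 < real (I n)"
      then have "exp ?E \<le> 0" using low by simp
      then show False using exp_gt_zero[of ?E] by linarith
    qed
    have IN: "I n \<le> N n" using nb(1) by (simp add: I_def N_def)
    have lnp: "ln ((real n + 1) ^ 4) = real n * err n"
      using n(2) by (simp add: err_def ln_realpow)
    have "?E \<le> ln ((real n + 1) ^ 4 * real (I n))"
      using low Ipos by (subst ln_ge_iff) auto
    also have "\<dots> = real n * err n + ln (real (I n))"
      using Ipos by (subst ln_mult) (auto simp: lnp)
    finally have "?E - real n * err n \<le> ln (real (I n))" by simp
    moreover have "?E - real n * err n = real n * L n"
      unfolding L_def entropy_mass_def T R by (simp add: algebra_simps)
    ultimately have 1: "L n \<le> ln (real (I n)) / real n"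
      using n(2) by (simp add: pos_le_divide_eq mult.commute)
    have Npos: "0 < real (N n)" using Ipos IN by simp
    have "ln (real (N n)) \<le> ln ((real n + 1) ^ 4 * exp (real n * f3 \<alpha> \<beta>))"
      using nb(2) Npos by (intro ln_mono) (auto simp: N_def)
    also have "\<dots> = real n * err n + real n * f3 \<alpha> \<beta>"
      by (subst ln_mult) (auto simp: lnp)
    finally have "ln (real (N n)) / real n \<le> f3 \<alpha> \<beta> + err n"
      using n(2) by (simp add: pos_divide_le_eq algebra_simps)
    with 1 n(2) Ipos IN show ?thesis by blast
  qed
  have "\<forall>\<^sub>F n in F. n \<in> S \<and> 0 < n"
    unfolding assms(9) eventually_inf_principal
    by (rule eventually_mono[OF eventually_gt_at_top[of 0]]) auto
  then have ev: "\<forall>\<^sub>F n in F. 0 < n \<and> 0 < real (I n) \<and> I n \<le> N n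
      \<and> L n \<le> ln (real (I n)) / real n \<and> ln (real (N n)) / real n \<le> f3 \<alpha> \<beta> + err n"
    by (rule eventually_mono) (use bounds in blast)
  have mono: "ln (real (I n)) / real n \<le> ln (real (N n)) / real n" if "0 < real (I n)" "I n \<le> N n" for n
    using that by (intro divide_right_mono ln_mono) auto
  \<comment> \<open>As \<open>I n \<le> N n\<close>, the lower bound for \<open>I\<close> and the
    upper bound for \<open>N\<close> enclose both sequences.\<close>
  have evI: "\<forall>\<^sub>F n in F. L n \<le> ln (real (I n)) / real n" "\<forall>\<^sub>F n in F. ln (real (I n)) / real n \<le> f3 \<alpha> \<beta> + err n"
    and evN: "\<forall>\<^sub>F n in F. L n \<le> ln (real (N n)) / real n" "\<forall>\<^sub>F n in F. ln (real (N n)) / real n \<le> f3 \<alpha> \<beta> + err n"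
    using ev by (eventually_elim; use mono order_trans in blast)+
  have pos: "\<forall>\<^sub>F n in F. 0 < n \<and> 0 < real (I n)" "\<forall>\<^sub>F n in F. 0 < n \<and> 0 < real (N n)"
    using ev by (eventually_elim; linarith)+
  have limI: "((\<lambda>n. ln (real (I n)) / real n) \<longlongrightarrow> f3 \<alpha> \<beta>) F"
    by (rule tendsto_sandwich[OF evI tendsto_mono[OF F L] tendsto_mono[OF F U]])
  have limN: "((\<lambda>n. ln (real (N n)) / real n) \<longlongrightarrow> f3 \<alpha> \<beta>) F"
    by (rule tendsto_sandwich[OF evN tendsto_mono[OF F L] tendsto_mono[OF F U]])
  show ?thesis
    using exp_form_of_log_rate[OF limI pos(1)] exp_form_of_log_rate(2)[OF limN pos(2)]
    unfolding I_def N_def by blast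
qed

end
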